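(* Let $\varepsilon\in (0,\frac{1}{12})$. Then, up to isomorphism, there is a finite number of finite groups $G$ such that $o(G)\in [\frac{13}{6}, \frac{9}{4}-\varepsilon)$.
   Context: For a finite group $G$ and $x\in G$, $o(x)$ denotes the order of the element $x$. The sum of element orders is $\psi(G)=\sum_{x\in G}o(x)$, and the average order of $G$ is $o(G)=\frac{\psi(G)}{|G|}$. *)

theory Defs
  imports "HOL-Algebra.Multiplicative_Group"
begin

definition sum_element_orders :: "('a, 'b) monoid_scheme \<Rightarrow> nat"
  where "sum_element_orders G = (\<Sum>x\<in>carrier G. group.ord G x)"

definition average_order :: "('a, 'b) monoid_scheme \<Rightarrow> real"
  where "average_order G = real (sum_element_orders G) / real (order G)"

end

theory Submission
  imports Defs
begin

text \<open>
  Let \<open>G\<close> be a finite group of order \<open>N\<close> in which exactly \<open>s\<close> elements square to the identity.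
  The identity has order 1, the other \<open>s - 1\<close> such elements have order 2, and all remaining
  elements have order at least 3; hence \<open>\<psi>(G) \<ge> 3 N - s - 1\<close>.

  If \<open>4 s > 3 N\<close>, then every element of \<open>G\<close> squares to the identity
  (\<open>square_one_of_three_quarters\<close>), so \<open>o(G) < 2 < 13/6\<close>. Otherwise \<open>\<psi>(G) \<ge> 9 N / 4 - 1\<close>,
  that is, \<open>o(G) \<ge> 9/4 - 1/N\<close>, and \<open>o(G) < 9/4 - \<epsilon>\<close> forces \<open>N < 1/\<epsilon>\<close>
  (\<open>order_less_of_average_order\<close>). There are only finitely many groups of bounded order up to
  isomorphism: each one is isomorphic to a group whose carrier is an initial segment of the natural
  numbers, and such a group is given by its multiplication table and its unit.
\<close>

section \<open>Groups in which more than three quarters of the elements square to the identity\<close>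

lemma (in group) subgroup_eq_carrier_of_half:
  assumes fin: "finite (carrier G)" and H: "subgroup H G" and half: "2 * card H > order G"
  shows "H = carrier G"
proof -
  have sub: "H \<subseteq> carrier G"
    using H by (rule subgroup.subset)
  have eq: "card (rcosets H) * card H = order G"
    using lagrange[OF H] .
  have pos: "order G > 0"
    using fin order_gt_0_iff_finite by blast
  have "card (rcosets H) < 2"
  proof (rule ccontr)
    assume "\<not> card (rcosets H) < 2"
    then have "2 * card H \<le> card (rcosets H) * card H"
      by (intro mult_right_mono) auto
    then show False
      using eq half by linarith
  qed
  moreover have "card (rcosets H) \<noteq> 0"
    using eq pos by (metis mult_0 less_irrefl)
  ultimately have "card (rcosets H) = 1"
    by linarith
  then have "card H = card (carrier G)"
    using eq by (simp add: order_def)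
  then show ?thesis
    using card_subset_eq[OF fin sub] by simp
qed

lemma (in group) subgroup_centralizer:
  assumes a: "a \<in> carrier G"
  shows "subgroup {x \<in> carrier G. a \<otimes> x = x \<otimes> a} G"
proof (rule subgroupI)
  fix x assume "x \<in> {x \<in> carrier G. a \<otimes> x = x \<otimes> a}"
  then have x: "x \<in> carrier G" "a \<otimes> x = x \<otimes> a"
    by auto
  have "a \<otimes> inv x = inv x \<otimes> (x \<otimes> a) \<otimes> inv x"
    using a x(1) by (simp flip: m_assoc)
  also have "\<dots> = inv x \<otimes> (a \<otimes> x) \<otimes> inv x"
    using x(2) by simp
  also have "\<dots> = inv x \<otimes> a"
    using a x(1) by (simp add: m_assoc)
  finally show "inv x \<in> {x \<in> carrier G. a \<otimes> x = x \<otimes> a}"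
    using x by simp
  fix y assume "y \<in> {x \<in> carrier G. a \<otimes> x = x \<otimes> a}"
  then have y: "y \<in> carrier G" "a \<otimes> y = y \<otimes> a"
    by auto
  have "a \<otimes> (x \<otimes> y) = x \<otimes> (a \<otimes> y)"
    using a x y(1) by (simp flip: m_assoc)
  also have "\<dots> = x \<otimes> y \<otimes> a"
    using a x(1) y by (simp add: m_assoc)
  finally show "x \<otimes> y \<in> {x \<in> carrier G. a \<otimes> x = x \<otimes> a}"
    using x y by simp
qed (use a in auto)

text \<open>
  If \<open>S\<close> is the set of elements that square to the identity and \<open>a \<in> S\<close>, then every \<open>x\<close> with
  \<open>x \<in> S\<close> and \<open>a x \<in> S\<close> commutes with \<open>a\<close>. When \<open>S\<close> exceeds three quarters of the group, these
  \<open>x\<close> make up more than half of it, so \<open>a\<close> is central. Then more than half of the group is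
  central, the group is abelian, and \<open>S\<close> is a subgroup containing more than half of the elements.
\<close>
lemma (in group) square_one_of_three_quarters:
  assumes fin: "finite (carrier G)"
    and large: "4 * card {x \<in> carrier G. x \<otimes> x = \<one>} > 3 * order G"
    and x: "x \<in> carrier G"
  shows "x \<otimes> x = \<one>"
proof -
  define S where "S = {x \<in> carrier G. x \<otimes> x = \<one>}"
  have S_sub: "S \<subseteq> carrier G" and S_large: "4 * card S > 3 * order G"
    using large by (auto simp: S_def)
  have fS: "finite S"
    using S_sub fin finite_subset by blast
  have central: "a \<otimes> y = y \<otimes> a" if a: "a \<in> S" and y: "y \<in> carrier G" for a y
  proof -
    have ac: "a \<in> carrier G" and aa: "a \<otimes> a = \<one>"
      using a by (auto simp: S_def)
    define T where "T = (\<lambda>x. a \<otimes> x) ` S"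
    define C where "C = {x \<in> carrier G. a \<otimes> x = x \<otimes> a}"
    have T_sub: "T \<subseteq> carrier G"
      using S_sub ac by (auto simp: T_def)
    have "card T = card S"
      unfolding T_def using S_sub inj_on_multc ac
      by (intro card_image) (auto simp: inj_on_def subset_iff)
    moreover have "card (S \<union> T) \<le> order G"
      unfolding order_def using S_sub T_sub fin by (intro card_mono) auto
    moreover have "card S + card T = card (S \<union> T) + card (S \<inter> T)"
      using fS by (intro card_Un_Int) (auto simp: T_def)
    ultimately have half: "2 * card (S \<inter> T) > order G"
      using S_large by linarith
    have "S \<inter> T \<subseteq> C"
    proof
      fix z assume z: "z \<in> S \<inter> T"
      then obtain w where w: "w \<in> carrier G" "w \<otimes> w = \<one>" "z = a \<otimes> w"
        by (auto simp: S_def T_def)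
      have zc: "z \<in> carrier G" and zz: "z \<otimes> z = \<one>"
        using z by (auto simp: S_def)
      have az: "a \<otimes> z = w"
        using w ac aa by (simp flip: m_assoc)
      have inv: "inv w = w" "inv z = z" "inv a = a"
        using w zc zz ac aa by (auto intro!: inv_equality)
      have "z \<otimes> a = inv (a \<otimes> z)"
        using zc ac inv by (simp add: inv_mult_group)
      also have "\<dots> = a \<otimes> z"
        using az inv by simp
      finally show "z \<in> C"
        using zc by (simp add: C_def)
    qed
    then have "card (S \<inter> T) \<le> card C"
      using fin by (intro card_mono) (auto simp: C_def)
    then have "2 * card C > order G"
      using half by linarith
    then have "C = carrier G"
      unfolding C_def by (rule subgroup_eq_carrier_of_half[OF fin subgroup_centralizer[OF ac]])
    then show ?thesis
      using y by (auto simp: C_def)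
  qed
  have comm: "y \<otimes> z = z \<otimes> y" if y: "y \<in> carrier G" and z: "z \<in> carrier G" for y z
  proof -
    define C where "C = {x \<in> carrier G. y \<otimes> x = x \<otimes> y}"
    have "S \<subseteq> C"
      using S_sub by (auto simp: C_def intro!: central[OF _ y, symmetric])
    then have "card S \<le> card C"
      using fin by (intro card_mono) (auto simp: C_def)
    then have "2 * card C > order G"
      using S_large by linarith
    then have "C = carrier G"
      unfolding C_def by (rule subgroup_eq_carrier_of_half[OF fin subgroup_centralizer[OF y]])
    then show ?thesis
      using z by (auto simp: C_def)
  qed
  have "subgroup S G"
  proof (rule subgroupI)
    show "S \<noteq> {}"
      by (auto simp: S_def)
    show "inv a \<in> S" if "a \<in> S" for a
      using that inv_equality[of a a] by (auto simp: S_def)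
    show "a \<otimes> b \<in> S" if ab: "a \<in> S" "b \<in> S" for a b
    proof -
      have c: "a \<in> carrier G" "b \<in> carrier G" "a \<otimes> a = \<one>" "b \<otimes> b = \<one>"
        using ab by (auto simp: S_def)
      have "(a \<otimes> b) \<otimes> (a \<otimes> b) = (a \<otimes> b) \<otimes> (b \<otimes> a)"
        using comm[OF c(1,2)] by (rule arg_cong[where f = "\<lambda>u. (a \<otimes> b) \<otimes> u"])
      also have "\<dots> = a \<otimes> (b \<otimes> b) \<otimes> a"
        using c(1,2) by (simp add: m_assoc)
      also have "\<dots> = \<one>"
        using c by simp
      finally show ?thesis
        using c by (simp add: S_def)
    qed
  qed (use S_sub in auto)
  then have "S = carrier G"
    using subgroup_eq_carrier_of_half[OF fin] S_large by simp
  then show ?thesis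
    using x by (auto simp: S_def)
qed

section \<open>Bounds on the average order\<close>

lemma (in group) sum_element_orders_ge:
  assumes fin: "finite (carrier G)"
  shows "sum_element_orders G + card {x \<in> carrier G. x \<otimes> x = \<one>} + 1 \<ge> 3 * order G"
proof -
  define S where "S = {x \<in> carrier G. x \<otimes> x = \<one>}"
  have fS: "finite S" and S_sub: "S \<subseteq> carrier G" and one: "\<one> \<in> S"
    using fin by (auto simp: S_def)
  have bound: "3 \<le> ord x + (if x \<in> S then 1 else 0) + (if x = \<one> then 1 else 0)"
    if x: "x \<in> carrier G" for x
  proof -
    have pos: "ord x \<ge> 1"
      using ord_ge_1[OF fin x] .
    have "x = \<one>" if "ord x = 1"
      using that ord_eq_1[OF x] by simp
    moreover have "x \<in> S" if "ord x = 2"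
      using that pow_ord_eq_1[OF x] x by (simp add: S_def numeral_2_eq_2)
    ultimately show ?thesis
      using pos one by (cases "ord x = 1"; cases "ord x = 2") auto
  qed
  have "3 * order G = (\<Sum>x\<in>carrier G. 3)"
    by (simp add: order_def)
  also have "\<dots> \<le> (\<Sum>x\<in>carrier G. ord x + (if x \<in> S then 1 else 0) + (if x = \<one> then 1 else 0))"
    using bound by (intro sum_mono) auto
  also have "\<dots> = sum_element_orders G + card S + 1"
    using fin S_sub by (simp add: sum.distrib sum_element_orders_def sum.If_cases Int_absorb1)
  finally show ?thesis
    by (simp add: S_def)
qed

lemma (in group) average_order_less_2_of_square_one:
  assumes fin: "finite (carrier G)" and sq: "\<And>x. x \<in> carrier G \<Longrightarrow> x \<otimes> x = \<one>"
  shows "average_order G < 2"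
proof -
  have "ord x \<le> 2" if x: "x \<in> carrier G" for x
  proof -
    have "x [^] (2::nat) = \<one>"
      using sq x by (simp add: numeral_2_eq_2)
    then show ?thesis
      using pow_eq_id[OF x] dvd_imp_le[of "ord x" 2] by simp
  qed
  then have "sum_element_orders G < (\<Sum>x\<in>carrier G. 2)"
    unfolding sum_element_orders_def using fin
    by (intro sum_strict_mono_ex1) (auto intro!: bexI[of _ \<one>])
  then have "real (sum_element_orders G) < 2 * real (order G)"
    by (simp add: order_def)
  moreover have "order G > 0"
    using fin order_gt_0_iff_finite by blast
  ultimately show ?thesis
    by (simp add: average_order_def divide_less_eq)
qed

lemma (in group) order_less_of_average_order:
  assumes fin: "finite (carrier G)" and "\<epsilon> > 0"
    and lower: "average_order G \<ge> 2" and upper: "average_order G < 9/4 - \<epsilon>"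
  shows "real (order G) < 1 / \<epsilon>"
proof -
  have pos: "order G > 0"
    using fin order_gt_0_iff_finite by blast
  have "\<not> 4 * card {x \<in> carrier G. x \<otimes> x = \<one>} > 3 * order G"
    using square_one_of_three_quarters[OF fin] average_order_less_2_of_square_one[OF fin] lower
    by force
  then have "4 * sum_element_orders G + 4 \<ge> 9 * order G"
    using sum_element_orders_ge[OF fin] by linarith
  then have "4 * real (sum_element_orders G) + 4 \<ge> 9 * real (order G)"
    by linarith
  moreover have "real (sum_element_orders G) < (9/4 - \<epsilon>) * real (order G)"
    using upper pos by (simp add: average_order_def divide_less_eq)
  ultimately have "\<epsilon> * real (order G) < 1"
    by (simp add: algebra_simps)
  then show ?thesis
    using \<open>\<epsilon> > 0\<close> by (simp add: less_divide_eq mult.commute)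
qed

lemma average_order_iso:
  assumes G: "group G" and H: "group H" and iso: "G \<cong> H"
  shows "average_order G = average_order H"
proof -
  interpret G: group G by (rule G)
  interpret H: group H by (rule H)
  obtain h where hom: "h \<in> hom G H" and bij: "bij_betw h (carrier G) (carrier H)"
    using iso by (auto simp: is_iso_def iso_def)
  have hc: "h x \<in> carrier H" if "x \<in> carrier G" for x
    using bij that bij_betwE by blast
  have h_one: "h \<one>\<^bsub>G\<^esub> = \<one>\<^bsub>H\<^esub>"
    using hom_one[OF hom G H] .
  have ord: "H.ord (h x) = G.ord x" if x: "x \<in> carrier G" for x
  proof -
    have "h x [^]\<^bsub>H\<^esub> n = \<one>\<^bsub>H\<^esub> \<longleftrightarrow> x [^]\<^bsub>G\<^esub> n = \<one>\<^bsub>G\<^esub>" for n :: nat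
    proof -
      have "h x [^]\<^bsub>H\<^esub> n = \<one>\<^bsub>H\<^esub> \<longleftrightarrow> h (x [^]\<^bsub>G\<^esub> n) = h \<one>\<^bsub>G\<^esub>"
        using hom_nat_pow[OF hom x G H] h_one by simp
      also have "\<dots> \<longleftrightarrow> x [^]\<^bsub>G\<^esub> n = \<one>\<^bsub>G\<^esub>"
        using bij x by (intro inj_on_eq_iff[of h "carrier G"]) (auto simp: bij_betw_def)
      finally show ?thesis .
    qed
    then show ?thesis
      using H.ord_unique[OF hc[OF x]] G.pow_eq_id[OF x] by simp
  qed
  have "sum_element_orders H = (\<Sum>x\<in>carrier G. H.ord (h x))"
    unfolding sum_element_orders_def using sum.reindex_bij_betw[OF bij, of H.ord] by simp
  then have "sum_element_orders H = sum_element_orders G"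
    using ord by (simp add: sum_element_orders_def)
  moreover have "order H = order G"
    using bij_betw_same_card[OF bij] by (simp add: order_def)
  ultimately show ?thesis
    by (simp add: average_order_def)
qed

section \<open>Finitely many groups of bounded order\<close>

text \<open>
  The multiplication tables on \<open>{0, ..., n - 1}\<close>, with a distinguished element as unit. Products
  outside the carrier are fixed by extensionality, so that there are only finitely many tables.
\<close>
definition table_monoids :: "nat \<Rightarrow> nat monoid set" where
  "table_monoids n =
     (\<lambda>(m, e). \<lparr>carrier = {..<n}, mult = m, one = e\<rparr>) `
       (({..<n} \<rightarrow>\<^sub>E {..<n} \<rightarrow>\<^sub>E {..<n}) \<times> {..<n})"

lemma finite_table_monoids: "finite (table_monoids n)"
  unfolding table_monoids_def by (intro finite_imageI finite_cartesian_product finite_PiE) auto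

lemma carrier_table_monoids:
  assumes "H \<in> table_monoids n"
  shows "carrier H = {..<n}"
proof -
  from assms obtain p where "H = (\<lambda>(m, e). \<lparr>carrier = {..<n}, mult = m, one = e\<rparr>) p"
    unfolding table_monoids_def by (rule imageE)
  then show ?thesis
    by (simp add: case_prod_unfold)
qed

lemma group_iso_table_monoid:
  fixes G (structure)
  assumes G: "group G" and fin: "finite (carrier G)"
  obtains H where "H \<in> table_monoids (order G)" "group H" "G \<cong> H"
proof -
  interpret group G by (rule G)
  define n where "n = order G"
  obtain f where f: "bij_betw f (carrier G) {..<n}"
    using ex_bij_betw_finite_nat[OF fin] by (auto simp: n_def order_def atLeast0LessThan)
  define g where "g = inv_into (carrier G) f"
  have g: "g i \<in> carrier G" if "i < n" for i
    using bij_betwE[OF bij_betw_inv_into[OF f]] that by (auto simp: g_def)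
  have gf: "g (f x) = x" if "x \<in> carrier G" for x
    using bij_betw_inv_into_left[OF f that] by (simp add: g_def)
  have fc: "f x < n" if "x \<in> carrier G" for x
    using bij_betwE[OF f] that by auto
  define m where "m = (\<lambda>i\<in>{..<n}. \<lambda>j\<in>{..<n}. f (g i \<otimes> g j))"
  define H where "H = \<lparr>carrier = {..<n}, mult = m, one = f \<one>\<rparr>"
  have "m \<in> {..<n} \<rightarrow>\<^sub>E {..<n} \<rightarrow>\<^sub>E {..<n}"
    using g fc by (auto simp: m_def intro!: restrict_PiE_iff[THEN iffD2])
  then have H_table: "H \<in> table_monoids (order G)"
    unfolding table_monoids_def H_def n_def[symmetric]
    using fc[OF one_closed] by (intro image_eqI[of _ _ "(m, f \<one>)"]) simp_all
  have iso: "f \<in> iso G H"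
    using f fc gf by (auto simp: iso_def hom_def H_def m_def)
  have "group (H \<lparr>one := f \<one>\<rparr>)"
    using iso_imp_img_group[OF iso] .
  then have "group H"
    by (simp add: H_def)
  then show thesis
    using that H_table is_isoI[OF iso] by blast
qed

theorem proposition2p9:
  fixes \<epsilon> :: real
  assumes "\<epsilon> \<in> {0<..<1/12}"
  shows "\<exists>\<S> :: nat monoid set.
      finite \<S> \<and>
      (\<forall>H\<in>\<S>. group H \<and> finite (carrier H) \<and> average_order H \<in> {13/6 ..< 9/4 - \<epsilon>}) \<and>
      (\<forall>G :: ('a, 'b) monoid_scheme.
         group G \<and> finite (carrier G) \<and> average_order G \<in> {13/6 ..< 9/4 - \<epsilon>} \<longrightarrow>
         (\<exists>H\<in>\<S>. G \<cong> H))"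
proof -
  define M where "M = nat \<lceil>1 / \<epsilon>\<rceil>"
  define \<S> where "\<S> = {H \<in> (\<Union>n\<in>{..M}. table_monoids n).
      group H \<and> average_order H \<in> {13/6 ..< 9/4 - \<epsilon>}}"
  have "finite \<S>"
    unfolding \<S>_def using finite_table_monoids by auto
  moreover have "group H \<and> finite (carrier H) \<and> average_order H \<in> {13/6 ..< 9/4 - \<epsilon>}"
    if "H \<in> \<S>" for H
    using that carrier_table_monoids by (fastforce simp: \<S>_def)
  moreover have "\<exists>H\<in>\<S>. G \<cong> H"
    if G: "group G" and fin: "finite (carrier G)"
      and avg: "average_order G \<in> {13/6 ..< 9/4 - \<epsilon>}" for G :: "('a, 'b) monoid_scheme"
  proof -
    have "real (order G) < 1 / \<epsilon>"
      using group.order_less_of_average_order[OF G fin, of \<epsilon>] assms avg by simp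
    then have "order G \<le> M"
      unfolding M_def by linarith
    moreover obtain H where "H \<in> table_monoids (order G)" "group H" "G \<cong> H"
      using group_iso_table_monoid[OF G fin] .
    ultimately show ?thesis
      using average_order_iso[OF G, of H] avg by (auto simp: \<S>_def)
  qed
  ultimately show ?thesis
    by blast
qed

end
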